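(* Let $p\in\{1,\infty\}$, let $d\ge1$ and let $\mathbf n=(n_1,\dots,n_d)$ be a tuple of positive integers. Then the ideal $I_p\subset\mathbb R[X]$ is real radical.
   Context: $[\mathbf n]=[n_1]\times\cdots\times[n_d]$ with $[m]=\{1,\dots,m\}$; $\mathbb R[X]$ is the polynomial ring in the variables $x_a$, $a\in[\mathbf n]$. For $a,b\in[\mathbf n]$, $a\wedge b=(\min(a_i,b_i))_i$ and $a\vee b=(\max(a_i,b_i))_i$. $I_1=\langle x_a^3-x_a\ (a\in[\mathbf n]),\ x_ax_b\ (a\ne b),\ \sum_{a}x_a^2-1\rangle$ and $I_\infty=\langle x_a^2-1\ (a\in[\mathbf n]),\ x_ax_b-x_{a\wedge b}x_{a\vee b}\ (a,b\in[\mathbf n])\rangle$. The real radical of an ideal $I\subset\mathbb R[X]$ is $\{f\in\mathbb R[X]:\exists\, n,m\in\mathbb N,\ g_1,\dots,g_m\in\mathbb R[X],\ f^{2n}+\sum_{i=1}^m g_i^2\in I\}$ (with $n\ge1$), and $I$ is real radical if it equals its real radical. *)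

theory Defs
  imports "HOL-Algebra.Ideal" "HOL-Library.Poly_Mapping" "HOL-Library.FuncSet"
    "HOL-Library.Extended_Nat"
begin

section \<open>Real polynomials in a set of variables\<close>

text \<open>A monomial is a finitely supported map from variables to exponents; a polynomial is a
  finitely supported map from monomials to coefficients. The arithmetic is that of
  \<^theory>\<open>HOL-Library.Poly_Mapping\<close>, where multiplication is convolution.\<close>

type_synonym 'x rpoly = "('x \<Rightarrow>\<^sub>0 nat) \<Rightarrow>\<^sub>0 real"

definition Var :: "'x \<Rightarrow> 'x rpoly" where
  "Var a = Poly_Mapping.single (Poly_Mapping.single a 1) 1"

text \<open>The ring \<open>\<real>[x\<^sub>a : a \<in> V]\<close> sits inside the polynomials over all variables of the
  index type, which may be more than \<open>V\<close>; ideals are therefore always taken in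
  \<open>poly_ring V\<close>, not in the whole type.\<close>

definition poly_ring :: "'x set \<Rightarrow> 'x rpoly ring" where
  "poly_ring V = \<lparr>carrier = {p. \<forall>m \<in> Poly_Mapping.keys p. Poly_Mapping.keys m \<subseteq> V},
     monoid.mult = (*), one = 1, zero = 0, add = (+)\<rparr>"

lemma poly_ring_simps [simp]:
  "monoid.mult (poly_ring V) = (*)"
  "one (poly_ring V) = 1"
  "zero (poly_ring V) = 0"
  "add (poly_ring V) = (+)"
  by (simp_all add: poly_ring_def)

lemma mem_poly_ring:
  "p \<in> carrier (poly_ring V) \<longleftrightarrow> (\<forall>m \<in> Poly_Mapping.keys p. Poly_Mapping.keys m \<subseteq> V)"
  by (simp add: poly_ring_def)

lemma poly_ring_zero: "0 \<in> carrier (poly_ring V)"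
  and poly_ring_one: "1 \<in> carrier (poly_ring V)"
  by (auto simp: mem_poly_ring)

lemma poly_ring_add:
  "p \<in> carrier (poly_ring V) \<Longrightarrow> q \<in> carrier (poly_ring V) \<Longrightarrow> p + q \<in> carrier (poly_ring V)"
  using Poly_Mapping.keys_add[of p q] unfolding mem_poly_ring by blast

lemma poly_ring_uminus:
  "p \<in> carrier (poly_ring V) \<Longrightarrow> - p \<in> carrier (poly_ring V)"
  unfolding mem_poly_ring by simp

lemma poly_ring_diff:
  "p \<in> carrier (poly_ring V) \<Longrightarrow> q \<in> carrier (poly_ring V) \<Longrightarrow> p - q \<in> carrier (poly_ring V)"
  using poly_ring_add[of p V "- q"] poly_ring_uminus[of q V] by simp

lemma poly_ring_mult:
  assumes "p \<in> carrier (poly_ring V)" "q \<in> carrier (poly_ring V)"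
  shows "p * q \<in> carrier (poly_ring V)"
  unfolding mem_poly_ring
proof
  fix m assume "m \<in> Poly_Mapping.keys (p * q)"
  then obtain a b where m: "m = a + b" and "a \<in> Poly_Mapping.keys p" "b \<in> Poly_Mapping.keys q"
    using Poly_Mapping.keys_mult[of p q] by auto
  with assms have "Poly_Mapping.keys a \<subseteq> V" "Poly_Mapping.keys b \<subseteq> V"
    by (auto simp: mem_poly_ring)
  then show "Poly_Mapping.keys m \<subseteq> V"
    using Poly_Mapping.keys_add[of a b] m by blast
qed

lemma poly_ring_power:
  "p \<in> carrier (poly_ring V) \<Longrightarrow> p ^ k \<in> carrier (poly_ring V)"
  by (induction k) (auto intro: poly_ring_one poly_ring_mult)

lemma poly_ring_sum:
  "(\<And>i. i \<in> A \<Longrightarrow> f i \<in> carrier (poly_ring V)) \<Longrightarrow> sum f A \<in> carrier (poly_ring V)"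
  by (induction A rule: infinite_finite_induct) (auto intro: poly_ring_zero poly_ring_add)

lemma poly_ring_Var: "a \<in> V \<Longrightarrow> Var a \<in> carrier (poly_ring V)"
  by (auto simp: mem_poly_ring Var_def)

lemma cring_poly_ring: "cring (poly_ring V)"
proof (rule cringI)
  show "abelian_group (poly_ring V)"
  proof (rule abelian_groupI)
    fix x assume "x \<in> carrier (poly_ring V)"
    then show "\<exists>y\<in>carrier (poly_ring V). y \<oplus>\<^bsub>poly_ring V\<^esub> x = \<zero>\<^bsub>poly_ring V\<^esub>"
      by (intro bexI[of _ "- x"]) (auto intro: poly_ring_uminus)
  qed (auto intro: poly_ring_zero poly_ring_add simp: algebra_simps)
  show "comm_monoid (poly_ring V)"
    by (rule comm_monoidI) (auto intro: poly_ring_one poly_ring_mult simp: algebra_simps)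
qed (auto simp: algebra_simps)

section \<open>Real radical ideals\<close>

definition real_radical :: "'x set \<Rightarrow> 'x rpoly set \<Rightarrow> 'x rpoly set" where
  "real_radical V I = {f \<in> carrier (poly_ring V).
     \<exists>n m :: nat. \<exists>g :: nat \<Rightarrow> 'x rpoly. n \<ge> 1 \<and> (\<forall>i\<in>{1..m}. g i \<in> carrier (poly_ring V)) \<and>
       f ^ (2 * n) + (\<Sum>i=1..m. (g i)\<^sup>2) \<in> I}"

definition is_real_radical :: "'x set \<Rightarrow> 'x rpoly set \<Rightarrow> bool" where
  "is_real_radical V I \<longleftrightarrow> real_radical V I = I"

section \<open>The ideals \<open>I\<^sub>1\<close> and \<open>I\<^sub>\<infinity>\<close>\<close>

text \<open>A multi-index is a function on \<open>{1..d}\<close>, made extensional so that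
  \<open>multi_indices d n\<close> is the product
  \<open>[n\<^sub>1] \<times> \<dots> \<times> [n\<^sub>d]\<close> without spurious duplicates.\<close>

type_synonym mindex = "nat \<Rightarrow> nat"

definition multi_indices :: "nat \<Rightarrow> (nat \<Rightarrow> nat) \<Rightarrow> mindex set" where
  "multi_indices d n = (\<Pi>\<^sub>E i\<in>{1..d}. {1..n i})"

definition mi_meet :: "nat \<Rightarrow> mindex \<Rightarrow> mindex \<Rightarrow> mindex" where
  "mi_meet d a b = (\<lambda>i\<in>{1..d}. min (a i) (b i))"

definition mi_join :: "nat \<Rightarrow> mindex \<Rightarrow> mindex \<Rightarrow> mindex" where
  "mi_join d a b = (\<lambda>i\<in>{1..d}. max (a i) (b i))"

definition gens_one :: "nat \<Rightarrow> (nat \<Rightarrow> nat) \<Rightarrow> mindex rpoly set" where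
  "gens_one d n =
     {Var a ^ 3 - Var a | a. a \<in> multi_indices d n} \<union>
     {Var a * Var b | a b. a \<in> multi_indices d n \<and> b \<in> multi_indices d n \<and> a \<noteq> b} \<union>
     {(\<Sum>a\<in>multi_indices d n. (Var a)\<^sup>2) - 1}"

definition gens_infinity :: "nat \<Rightarrow> (nat \<Rightarrow> nat) \<Rightarrow> mindex rpoly set" where
  "gens_infinity d n =
     {(Var a)\<^sup>2 - 1 | a. a \<in> multi_indices d n} \<union>
     {Var a * Var b - Var (mi_meet d a b) * Var (mi_join d a b) | a b. a \<in> multi_indices d n \<and> b \<in> multi_indices d n}"

text \<open>Only the values \<open>p = 1\<close> and \<open>p = \<infinity>\<close> are meaningful here.\<close>

definition norm_ideal :: "enat \<Rightarrow> nat \<Rightarrow> (nat \<Rightarrow> nat) \<Rightarrow> mindex rpoly set" where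
  "norm_ideal p d n =
     Idl\<^bsub>poly_ring (multi_indices d n)\<^esub> (if p = 1 then gens_one d n else gens_infinity d n)"

lemma mi_meet_in_multi_indices: "a \<in> multi_indices d n \<Longrightarrow> b \<in> multi_indices d n \<Longrightarrow> mi_meet d a b \<in> multi_indices d n"
  unfolding multi_indices_def mi_meet_def by (fastforce simp: min_def PiE_def Pi_def)

lemma mi_join_in_multi_indices: "a \<in> multi_indices d n \<Longrightarrow> b \<in> multi_indices d n \<Longrightarrow> mi_join d a b \<in> multi_indices d n"
  unfolding multi_indices_def mi_join_def by (fastforce simp: max_def PiE_def Pi_def)

lemma gens_one_subset: "gens_one d n \<subseteq> carrier (poly_ring (multi_indices d n))"
  unfolding gens_one_def
  by (auto intro!: poly_ring_diff poly_ring_power poly_ring_mult poly_ring_sum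
        poly_ring_one poly_ring_Var)

lemma gens_infinity_subset: "gens_infinity d n \<subseteq> carrier (poly_ring (multi_indices d n))"
  unfolding gens_infinity_def
  by (auto intro!: poly_ring_diff poly_ring_power poly_ring_mult
        poly_ring_one poly_ring_Var mi_meet_in_multi_indices mi_join_in_multi_indices)

lemma ideal_norm_ideal: "ideal (norm_ideal p d n) (poly_ring (multi_indices d n))"
proof -
  interpret cring "poly_ring (multi_indices d n)" by (rule cring_poly_ring)
  show ?thesis
    unfolding norm_ideal_def
    using gens_one_subset gens_infinity_subset by (intro genideal_ideal) auto
qed

end

theory Submission
  imports Defs
begin

text \<open>Both ideals contain \<open>x\<^sub>a\<^sup>3 - x\<^sub>a\<close> for every variable, and this alone makes an ideal \<open>I\<close> of a
  real polynomial ring in finitely many variables real radical: modulo \<open>I\<close> each variable takes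
  one of the real values \<open>-1\<close>, \<open>0\<close>, \<open>1\<close>, so the quotient is a quotient of the algebra of all
  real functions on the finite grid \<open>{-1, 0, 1}\<^sup>V\<close>, hence itself an algebra of real functions on a
  finite set. There a sum of squares vanishes only if every summand does.

  Concretely, let \<open>e\<^sub>v\<close> be the Lagrange interpolation polynomial that is \<open>1\<close> at the grid point \<open>v\<close>
  and \<open>0\<close> at all others. These polynomials sum to \<open>1\<close> (\<open>sum_grid_indicator\<close>), and modulo \<open>I\<close> each of
  them is a simultaneous eigenvector of all polynomials with real eigenvalues
  (\<open>grid_indicator_eigenvalue\<close>). Let \<open>f\<^sup>2\<^sup>n + \<Sum> g\<^sub>i\<^sup>2 \<in> I\<close>. This element acts on \<open>e\<^sub>v\<close> by
  \<open>c\<^sup>2\<^sup>n + \<Sum> c\<^sub>i\<^sup>2\<close>, where \<open>c\<close> and \<open>c\<^sub>i\<close> are the eigenvalues of \<open>f\<close> and \<open>g\<^sub>i\<close>. Either this number is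
  positive, and then \<open>e\<^sub>v \<in> I\<close>; or it is zero, and then \<open>c = 0\<close>. In both cases \<open>f e\<^sub>v \<in> I\<close>
  (\<open>eigenvector_absorbs_real_radical\<close>), and summing over \<open>v\<close> gives \<open>f \<in> I\<close>.\<close>

section \<open>Polynomials generated by constants and variables\<close>

definition Const :: "real \<Rightarrow> 'x rpoly" where
  "Const c = Poly_Mapping.single 0 c"

lemma Const_add: "Const (b + c) = Const b + Const c"
  by (simp add: Const_def single_add)

lemma Const_mult: "Const (b * c) = Const b * Const c"
  by (simp add: Const_def mult_single)

lemma Const_diff: "Const (b - c) = Const b - Const c"
  by (simp add: Const_def single_diff)

lemma Const_0 [simp]: "Const 0 = 0"
  by (simp add: Const_def)

lemma Const_1 [simp]: "Const 1 = 1"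
  by (simp add: Const_def)

lemma Const_in_poly_ring: "Const c \<in> carrier (poly_ring V)"
  by (auto simp: mem_poly_ring Const_def)

lemma poly_mapping_sum_singles:
  "p = (\<Sum>m\<in>Poly_Mapping.keys p. Poly_Mapping.single m (Poly_Mapping.lookup p m))"
proof (rule poly_mapping_eqI)
  fix k
  have "(\<Sum>m\<in>Poly_Mapping.keys p. Poly_Mapping.lookup (Poly_Mapping.single m (Poly_Mapping.lookup p m)) k)
      = (\<Sum>m\<in>Poly_Mapping.keys p. if m = k then Poly_Mapping.lookup p m else 0)"
    by (intro sum.cong) (auto simp: lookup_single when_def)
  also have "\<dots> = Poly_Mapping.lookup p k"
    by (simp add: in_keys_iff)
  finally show "Poly_Mapping.lookup p k =
      Poly_Mapping.lookup (\<Sum>m\<in>Poly_Mapping.keys p. Poly_Mapping.single m (Poly_Mapping.lookup p m)) k"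
    by (simp add: lookup_sum)
qed

lemma prod_monomials:
  "(\<Prod>a\<in>A. Poly_Mapping.single (h a) (1::real)) = Poly_Mapping.single (\<Sum>a\<in>A. h a) 1"
  by (induction A rule: infinite_finite_induct) (auto simp: mult_single)

lemma Var_power: "Var a ^ k = Poly_Mapping.single (Poly_Mapping.single a k) 1"
  by (induction k) (auto simp: Var_def mult_single simp flip: single_add)

text \<open>A structural induction principle: the ring is generated by constants and variables.\<close>

lemma poly_ring_induct [consumes 1, case_names const var add mult]:
  assumes p: "p \<in> carrier (poly_ring V)"
    and const: "\<And>c. P (Const c)"
    and var: "\<And>a. a \<in> V \<Longrightarrow> P (Var a)"
    and add: "\<And>f g. f \<in> carrier (poly_ring V) \<Longrightarrow> g \<in> carrier (poly_ring V) \<Longrightarrow>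
      P f \<Longrightarrow> P g \<Longrightarrow> P (f + g)"
    and mult: "\<And>f g. f \<in> carrier (poly_ring V) \<Longrightarrow> g \<in> carrier (poly_ring V) \<Longrightarrow>
      P f \<Longrightarrow> P g \<Longrightarrow> P (f * g)"
  shows "P p"
proof -
  let ?Q = "\<lambda>f. f \<in> carrier (poly_ring V) \<and> P f"
  have Q_power: "?Q (f ^ k)" if "?Q f" for f and k :: nat
    using that const[of 1] by (induction k) (auto intro: mult poly_ring_mult poly_ring_one)
  have Q_prod: "?Q (\<Prod>a\<in>A. h a)" if "\<And>a. a \<in> A \<Longrightarrow> ?Q (h a)" for A and h :: "'a \<Rightarrow> 'a rpoly"
    using that const[of 1]
    by (induction A rule: infinite_finite_induct) (auto intro: mult poly_ring_mult poly_ring_one)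
  have Q_sum: "?Q (\<Sum>m\<in>A. h m)" if "\<And>m. m \<in> A \<Longrightarrow> ?Q (h m)" for A and h :: "('a \<Rightarrow>\<^sub>0 nat) \<Rightarrow> 'a rpoly"
    using that const[of 0]
    by (induction A rule: infinite_finite_induct) (auto intro: add poly_ring_add poly_ring_zero)
  have "?Q (Poly_Mapping.single m c)" if m: "Poly_Mapping.keys m \<subseteq> V" for m c
  proof -
    have "Poly_Mapping.single m 1
        = (\<Prod>a\<in>Poly_Mapping.keys m. Var a ^ Poly_Mapping.lookup m a :: 'a rpoly)"
      unfolding Var_power
      by (subst poly_mapping_sum_singles[of m]) (rule prod_monomials[symmetric])
    moreover have "?Q (\<Prod>a\<in>Poly_Mapping.keys m. Var a ^ Poly_Mapping.lookup m a)"
      using m by (intro Q_prod Q_power) (auto intro: var poly_ring_Var)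
    ultimately have "?Q (Const c * Poly_Mapping.single m 1)"
      by (auto intro: mult const Const_in_poly_ring poly_ring_mult)
    then show ?thesis
      by (simp add: Const_def mult_single)
  qed
  then have "?Q (\<Sum>m\<in>Poly_Mapping.keys p. Poly_Mapping.single m (Poly_Mapping.lookup p m))"
    using p by (intro Q_sum) (auto simp: mem_poly_ring)
  then show ?thesis
    by (simp flip: poly_mapping_sum_singles)
qed

section \<open>Eigenvectors modulo an ideal\<close>

locale poly_ideal =
  fixes V :: "'x set" and I :: "'x rpoly set"
  assumes ideal: "ideal I (poly_ring V)"
begin

lemma in_carrier: "f \<in> I \<Longrightarrow> f \<in> carrier (poly_ring V)"
  using ideal.Icarr[OF ideal] .

lemma zero_mem: "0 \<in> I"
  using additive_subgroup.zero_closed[OF ideal.axioms(1)[OF ideal]] by simp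

lemma add_mem: "f \<in> I \<Longrightarrow> g \<in> I \<Longrightarrow> f + g \<in> I"
  using additive_subgroup.a_closed[OF ideal.axioms(1)[OF ideal]] by simp

lemma mult_mem: "f \<in> carrier (poly_ring V) \<Longrightarrow> g \<in> I \<Longrightarrow> f * g \<in> I"
  using ideal.I_l_closed[OF ideal] by simp

lemma diff_mem: "f \<in> I \<Longrightarrow> g \<in> I \<Longrightarrow> f - g \<in> I"
  using add_mem[of f "- g"] mult_mem[of "- 1" g] by (simp add: poly_ring_uminus poly_ring_one)

lemma sum_mem: "(\<And>i. i \<in> A \<Longrightarrow> f i \<in> I) \<Longrightarrow> sum f A \<in> I"
  by (induction A rule: infinite_finite_induct) (auto intro: zero_mem add_mem)

text \<open>The class of \<open>e\<close> in the quotient may be zero; then every number is an eigenvalue.\<close>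

definition eigenvalue :: "'x rpoly \<Rightarrow> 'x rpoly \<Rightarrow> real \<Rightarrow> bool" where
  "eigenvalue e f c \<longleftrightarrow> f * e - Const c * e \<in> I"

lemma eigenvalue_Const: "eigenvalue e (Const c) c"
  by (simp add: eigenvalue_def zero_mem)

lemma eigenvalue_add: "eigenvalue e f b \<Longrightarrow> eigenvalue e g c \<Longrightarrow> eigenvalue e (f + g) (b + c)"
  unfolding eigenvalue_def Const_add by (drule (1) add_mem) (simp add: algebra_simps)

lemma eigenvalue_mult:
  assumes "eigenvalue e f b" "eigenvalue e g c" "f \<in> carrier (poly_ring V)"
  shows "eigenvalue e (f * g) (b * c)"
proof -
  have "f * (g * e - Const c * e) + Const c * (f * e - Const b * e) \<in> I"
    using assms unfolding eigenvalue_def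
    by (intro add_mem mult_mem Const_in_poly_ring)
  then show ?thesis
    unfolding eigenvalue_def Const_mult by (simp add: algebra_simps)
qed

lemma eigenvalue_power:
  "eigenvalue e f c \<Longrightarrow> f \<in> carrier (poly_ring V) \<Longrightarrow> eigenvalue e (f ^ k) (c ^ k)"
  using eigenvalue_Const[of e 1] by (induction k) (auto intro: eigenvalue_mult)

lemma eigenvalue_sum:
  "(\<And>i. i \<in> A \<Longrightarrow> eigenvalue e (f i) (c i)) \<Longrightarrow> eigenvalue e (sum f A) (sum c A)"
  using eigenvalue_Const[of e 0]
  by (induction A rule: infinite_finite_induct) (auto intro: eigenvalue_add)

lemma eigenvalue_mult_right:
  assumes "eigenvalue e f c" "h \<in> carrier (poly_ring V)"
  shows "eigenvalue (h * e) f c"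
  using mult_mem[OF assms(2) assms(1)[unfolded eigenvalue_def]]
  unfolding eigenvalue_def by (simp add: algebra_simps)

lemma eigenvalue_if_variables:
  assumes "\<And>a. a \<in> V \<Longrightarrow> \<exists>c. eigenvalue e (Var a) c" and "f \<in> carrier (poly_ring V)"
  shows "\<exists>c. eigenvalue e f c"
  using assms(2)
proof (induction rule: poly_ring_induct)
  case (const c)
  show ?case using eigenvalue_Const by blast
next
  case (var a)
  then show ?case by (rule assms(1))
next
  case (add f g)
  then show ?case using eigenvalue_add by blast
next
  case (mult f g)
  then show ?case using eigenvalue_mult by blast
qed

text \<open>A nonzero scalar that annihilates \<open>e\<close> modulo the ideal can be divided out.\<close>

lemma eigenvector_mem_if_eigenvalue_nonzero:
  assumes "eigenvalue e h c" "h \<in> I" "c \<noteq> 0" "e \<in> carrier (poly_ring V)"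
  shows "e \<in> I"
proof -
  have "e * h - (h * e - Const c * e) \<in> I"
    using assms mult_mem diff_mem unfolding eigenvalue_def by blast
  then have "Const c * e \<in> I"
    by (simp add: mult.commute)
  then have "Const (1 / c) * (Const c * e) \<in> I"
    by (rule mult_mem[OF Const_in_poly_ring])
  moreover have "Const (1 / c) * (Const c * e) = Const (1 / c * c) * e"
    by (simp only: Const_mult mult.assoc)
  ultimately show ?thesis
    using \<open>c \<noteq> 0\<close> by simp
qed

text \<open>This is where reality enters: the eigenvalue of \<open>f\<^sup>2\<^sup>n + \<Sum> g\<^sub>i\<^sup>2\<close> is a sum of squares of real
  numbers, so it is nonzero as soon as the eigenvalue of \<open>f\<close> is.\<close>

lemma eigenvector_absorbs_real_radical:
  assumes e: "e \<in> carrier (poly_ring V)"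
    and eig: "\<And>h. h \<in> carrier (poly_ring V) \<Longrightarrow> \<exists>c. eigenvalue e h c"
    and f: "f \<in> real_radical V I"
  shows "f * e \<in> I"
proof -
  obtain n m :: nat and g where fV: "f \<in> carrier (poly_ring V)"
    and gV: "\<And>i. i \<in> {1..m} \<Longrightarrow> g i \<in> carrier (poly_ring V)"
    and mem: "f ^ (2 * n) + (\<Sum>i=1..m. (g i)\<^sup>2) \<in> I"
    using f unfolding real_radical_def by blast
  obtain c where c: "eigenvalue e f c"
    using eig fV by blast
  have "\<forall>i\<in>{1..m}. \<exists>b. eigenvalue e (g i) b"
    using eig gV by blast
  then obtain b where b: "\<And>i. i \<in> {1..m} \<Longrightarrow> eigenvalue e (g i) (b i)"
    using bchoice[of "{1..m}" "\<lambda>i. eigenvalue e (g i)"] by blast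
  have eig_sum: "eigenvalue e (f ^ (2 * n) + (\<Sum>i=1..m. (g i)\<^sup>2)) (c ^ (2 * n) + (\<Sum>i=1..m. (b i)\<^sup>2))"
    by (intro eigenvalue_add eigenvalue_sum eigenvalue_power b c fV gV)
  show ?thesis
  proof (cases "c = 0")
    case True
    then show ?thesis
      using c by (simp add: eigenvalue_def)
  next
    case False
    then have "c ^ (2 * n) > 0"
      by (simp add: power_mult)
    moreover have "(\<Sum>i=1..m. (b i)\<^sup>2) \<ge> 0"
      by (intro sum_nonneg) simp
    ultimately have "e \<in> I"
      using eigenvector_mem_if_eigenvalue_nonzero[OF eig_sum mem _ e] by linarith
    then show ?thesis
      using mult_mem fV by blast
  qed
qed

lemma subset_real_radical: "I \<subseteq> real_radical V I"
proof
  fix f assume "f \<in> I"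
  moreover from this have "f ^ (2 * 1) + (\<Sum>i=1..0::nat. (0::'x rpoly)\<^sup>2) \<in> I"
    using mult_mem[of f f] in_carrier by (simp add: power2_eq_square)
  ultimately show "f \<in> real_radical V I"
    unfolding real_radical_def using in_carrier
    by (intro CollectI conjI exI[of _ 1] exI[of _ "0::nat"] exI[of _ "\<lambda>_. 0"]) auto
qed

end

section \<open>Ideals containing \<open>x\<^sup>3 - x\<close> for every variable\<close>

text \<open>The Lagrange basis polynomials of the nodes \<open>-1\<close>, \<open>0\<close>, \<open>1\<close>; the last case is meant
  for the node \<open>-1\<close>.\<close>

definition node_indicator :: "'x \<Rightarrow> real \<Rightarrow> 'x rpoly" where
  "node_indicator a c =
    (if c = 0 then 1 - (Var a)\<^sup>2
     else if c = 1 then Const (1/2) * ((Var a)\<^sup>2 + Var a)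
     else Const (1/2) * ((Var a)\<^sup>2 - Var a))"

definition grid_indicator :: "'x set \<Rightarrow> ('x \<Rightarrow> real) \<Rightarrow> 'x rpoly" where
  "grid_indicator V v = (\<Prod>a\<in>V. node_indicator a (v a))"

lemma node_indicator_in_poly_ring: "a \<in> V \<Longrightarrow> node_indicator a c \<in> carrier (poly_ring V)"
  unfolding node_indicator_def
  by (auto intro!: poly_ring_diff poly_ring_add poly_ring_mult poly_ring_power poly_ring_one
      poly_ring_Var Const_in_poly_ring)

lemma prod_node_indicator_in_poly_ring:
  "A \<subseteq> V \<Longrightarrow> (\<Prod>a\<in>A. node_indicator a (v a)) \<in> carrier (poly_ring V)"
  by (induction A rule: infinite_finite_induct)
     (auto intro: poly_ring_mult poly_ring_one node_indicator_in_poly_ring)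

lemma sum_node_indicator: "(\<Sum>c\<in>{-1, 0, 1}. node_indicator a c) = 1"
proof -
  have "Const (1/2) + Const (1/2) = (1 :: 'a rpoly)"
    by (simp flip: Const_add)
  then have half: "Const (1/2) * x + Const (1/2) * x = x" for x :: "'a rpoly"
    by (metis distrib_right mult_1)
  show ?thesis
    using half[of "(Var a)\<^sup>2"] by (simp add: node_indicator_def algebra_simps)
qed

text \<open>Expanding the product over all variables of the partitions of unity
  \<open>sum_node_indicator\<close> produces one summand for each grid point.\<close>

lemma sum_grid_indicator:
  assumes "finite V"
  shows "(\<Sum>v\<in>(\<Pi>\<^sub>E a\<in>V. {-1, 0, 1}). grid_indicator V v) = 1"
proof -
  have "(\<Sum>v\<in>(\<Pi>\<^sub>E a\<in>V. {-1, 0, 1}). grid_indicator V v)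
      = (\<Prod>a\<in>V. \<Sum>c\<in>{-1, 0, 1}. node_indicator a c)"
    unfolding grid_indicator_def using assms by (subst prod_sum_PiE) auto
  then show ?thesis
    by (simp only: sum_node_indicator prod.neutral_const)
qed

locale cube_poly_ideal = poly_ideal +
  assumes finite_variables: "finite V"
    and cube_mem: "a \<in> V \<Longrightarrow> Var a ^ 3 - Var a \<in> I"
begin

text \<open>The reason is the identity \<open>x\<^sup>3 - x = (x + 1) x (x - 1)\<close>: up to a scalar, the indicator of a
  node \<open>c\<close> is the product of the two factors other than \<open>x - c\<close>.\<close>

lemma node_indicator_eigenvalue:
  assumes a: "a \<in> V" and c: "c \<in> {-1, 0, 1}"
  shows "eigenvalue (node_indicator a c) (Var a) c"
proof -
  let ?cube = "Var a ^ 3 - Var a"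
  have minus: "Const (- 1) = (- 1 :: 'a rpoly)"
    using Const_diff[of 0 1] by simp
  consider "c = 0" | "c = 1" | "c = -1"
    using c by auto
  then show ?thesis
  proof cases
    case 1
    have "- 1 * ?cube \<in> I"
      by (intro mult_mem cube_mem a poly_ring_uminus poly_ring_one)
    moreover have "Var a * node_indicator a c - Const c * node_indicator a c = - 1 * ?cube"
      using 1 by (simp add: node_indicator_def algebra_simps power2_eq_square power3_eq_cube)
    ultimately show ?thesis
      by (simp only: eigenvalue_def)
  next
    case 2
    have "Const (1/2) * ?cube \<in> I"
      by (intro mult_mem cube_mem a Const_in_poly_ring)
    moreover have "Var a * node_indicator a c - Const c * node_indicator a c = Const (1/2) * ?cube"
      using 2 by (simp add: node_indicator_def algebra_simps power2_eq_square power3_eq_cube)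
    ultimately show ?thesis
      by (simp only: eigenvalue_def)
  next
    case 3
    have "Const (1/2) * ?cube \<in> I"
      by (intro mult_mem cube_mem a Const_in_poly_ring)
    moreover have "Var a * node_indicator a c - Const c * node_indicator a c = Const (1/2) * ?cube"
      using 3 by (simp add: node_indicator_def minus algebra_simps power2_eq_square power3_eq_cube)
    ultimately show ?thesis
      by (simp only: eigenvalue_def)
  qed
qed

lemma grid_indicator_eigenvalue:
  assumes v: "v \<in> (\<Pi>\<^sub>E a\<in>V. {-1, 0, 1})" and f: "f \<in> carrier (poly_ring V)"
  shows "\<exists>c. eigenvalue (grid_indicator V v) f c"
proof (rule eigenvalue_if_variables[OF _ f])
  fix a assume a: "a \<in> V"
  have "grid_indicator V v = (\<Prod>b\<in>V - {a}. node_indicator b (v b)) * node_indicator a (v a)"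
    unfolding grid_indicator_def
    by (subst prod.remove[OF finite_variables a]) (rule mult.commute)
  moreover have "v a \<in> {-1, 0, 1}"
    using PiE_mem[OF v a] .
  ultimately show "\<exists>c. eigenvalue (grid_indicator V v) (Var a) c"
    using eigenvalue_mult_right[OF node_indicator_eigenvalue[OF a]]
      prod_node_indicator_in_poly_ring[of "V - {a}" V v] by auto
qed

theorem ideal_is_real_radical: "is_real_radical V I"
proof -
  have "f \<in> I" if f: "f \<in> real_radical V I" for f
  proof -
    have "(\<Sum>v\<in>(\<Pi>\<^sub>E a\<in>V. {-1, 0, 1}). f * grid_indicator V v) \<in> I"
      by (intro sum_mem eigenvector_absorbs_real_radical grid_indicator_eigenvalue f)
         (auto simp: grid_indicator_def intro: prod_node_indicator_in_poly_ring)
    then show ?thesis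
      by (simp add: sum_grid_indicator finite_variables flip: sum_distrib_left)
  qed
  then show ?thesis
    unfolding is_real_radical_def using subset_real_radical by blast
qed

end

section \<open>The ideals \<open>I\<^sub>1\<close> and \<open>I\<^sub>\<infinity>\<close>\<close>

lemma finite_multi_indices: "finite (multi_indices d n)"
  unfolding multi_indices_def by (intro finite_PiE) auto

lemma cube_mem_norm_ideal:
  assumes a: "a \<in> multi_indices d n"
  shows "Var a ^ 3 - Var a \<in> norm_ideal p d n"
proof -
  let ?R = "poly_ring (multi_indices d n)"
  interpret cring ?R
    by (rule cring_poly_ring)
  interpret poly_ideal "multi_indices d n" "norm_ideal p d n"
    by (intro poly_ideal.intro ideal_norm_ideal)
  show ?thesis
  proof (cases "p = 1")
    case True
    have "Var a ^ 3 - Var a \<in> gens_one d n"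
      using a unfolding gens_one_def by blast
    then show ?thesis
      using genideal_self[OF gens_one_subset] True unfolding norm_ideal_def by auto
  next
    case False
    have "(Var a)\<^sup>2 - 1 \<in> gens_infinity d n"
      using a unfolding gens_infinity_def by blast
    then have "(Var a)\<^sup>2 - 1 \<in> norm_ideal p d n"
      using genideal_self[OF gens_infinity_subset] False unfolding norm_ideal_def by auto
    then have "Var a * ((Var a)\<^sup>2 - 1) \<in> norm_ideal p d n"
      by (intro mult_mem poly_ring_Var a)
    then show ?thesis
      by (simp add: algebra_simps power2_eq_square power3_eq_cube)
  qed
qed

theorem proposition3p5:
  fixes p :: enat and d :: nat and n :: "nat \<Rightarrow> nat"
  assumes "p \<in> {1, \<infinity>}"
    and "d \<ge> 1"
    and "\<And>i. i \<in> {1..d} \<Longrightarrow> n i \<ge> 1"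
  shows "is_real_radical (multi_indices d n) (norm_ideal p d n)"
proof -
  interpret cube_poly_ideal "multi_indices d n" "norm_ideal p d n"
    by (intro cube_poly_ideal.intro poly_ideal.intro cube_poly_ideal_axioms.intro
        ideal_norm_ideal finite_multi_indices cube_mem_norm_ideal)
  show ?thesis
    by (rule ideal_is_real_radical)
qed

end
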